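(* Let $(G,w,w_e)$ be a connected graph with weights $w:V(G)\to[0,\infty)$ and $w_e:E(G)\to[0,\infty)$, let $c\in V(G)$, let $C=[c]_R=\{c_1,\ldots,c_k\}$ and $N(c)=\{n_1,\ldots,n_s\}$. Let $G'=G\setminus(C\setminus\{c\})$ (delete the vertices of $C$ other than $c$), define $w':V(G')\to[0,\infty)$ by $w'(c)=\sum_{i=1}^k w(c_i)$ and $w'(v)=w(v)$ for $v\in V(G)\setminus C$, and define $w_e':E(G')\to[0,\infty)$ by $w_e'(cn_j)=\sum_{i=1}^k w_e(c_in_j)$ for $j\in\{1,\ldots,s\}$ and $w_e'(e)=w_e(e)$ for $e\in E(G)\setminus I(C)$. Then $$W_{ve}(G,w,w_e)=W_{ve}(G',w',w_e')+\sum_{i=1}^k\ \sum_{c_r\in C\setminus\{c_i\}}\ \sum_{e\in I(c_r)}w(c_i)w_e(e).$$ Moreover, if $w(c_i)=a$ for all $i\in\{1,\ldots,k\}$ and $w_e(e)=b$ for all $e\in I(C)$, where $a,b\in[0,\infty)$, then $$W_{ve}(G,w,w_e)=W_{ve}(G',w',w_e')+abk(k-1)s.$$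
   Context: All graphs are finite and simple; $N(v)$ is the set of neighbours of $v$, and $d_G(u,v)$ is the shortest-path distance. For a vertex $v$ and an edge $e=xy$, $d_G(v,e)=\min\{d_G(v,x),d_G(v,y)\}$, and $W_{ve}(G,w,w_e)=\sum_{v\in V(G)}\sum_{e\in E(G)}w(v)w_e(e)d_G(v,e)$. Vertices $u,v$ are in relation $R$ if $N(u)=N(v)$; this is an equivalence relation, and $[v]_R$ denotes the class of $v$. With $C$ and $N(c)$ as in the claim (all $c_i$ have neighbourhood $N(c)$), let $I(c_i)=\{c_in_j: j=1,\ldots,s\}$ (edges incident to $c_i$) and $I(C)=\bigcup_{i=1}^k I(c_i)$ (edges incident to a vertex of $C$). *)

theory Defs
  imports Complex_Main
begin

record 'a ugraph =
  verts :: "'a set"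
  edges :: "'a set set"

definition simple_graph :: "'a ugraph \<Rightarrow> bool" where
  "simple_graph G \<longleftrightarrow>
     finite (verts G) \<and> (\<forall>e\<in>edges G. e \<subseteq> verts G \<and> card e = 2)"

definition nbhd :: "'a ugraph \<Rightarrow> 'a \<Rightarrow> 'a set" where
  "nbhd G v = {u \<in> verts G. {v, u} \<in> edges G}"

text \<open>A path is the nonempty list of its pairwise distinct vertices; its length is the
  number of edges, i.e. one less than the length of the list.\<close>

definition path_between :: "'a ugraph \<Rightarrow> 'a \<Rightarrow> 'a list \<Rightarrow> 'a \<Rightarrow> bool" where
  "path_between G u p v \<longleftrightarrow>
     p \<noteq> [] \<and> hd p = u \<and> last p = v \<and> set p \<subseteq> verts G \<and> distinct p \<and>
     successively (\<lambda>x y. {x, y} \<in> edges G) p"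

definition connected_graph :: "'a ugraph \<Rightarrow> bool" where
  "connected_graph G \<longleftrightarrow>
     verts G \<noteq> {} \<and> (\<forall>u\<in>verts G. \<forall>v\<in>verts G. \<exists>p. path_between G u p v)"

text \<open>The distance has no meaning for vertices in different components.\<close>

definition gdist :: "'a ugraph \<Rightarrow> 'a \<Rightarrow> 'a \<Rightarrow> nat" where
  "gdist G u v = (LEAST n. \<exists>p. path_between G u p v \<and> n = length p - 1)"

definition gdist_edge :: "'a ugraph \<Rightarrow> 'a \<Rightarrow> 'a set \<Rightarrow> nat" where
  "gdist_edge G v e = Min (gdist G v ` e)"

lemma gdist_edge_doubleton: "gdist_edge G v {x, y} = min (gdist G v x) (gdist G v y)"
  by (simp add: gdist_edge_def)

text \<open>Weights are total functions; only their values on vertices and edges of the graph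
  matter.\<close>

definition W_ve :: "'a ugraph \<Rightarrow> ('a \<Rightarrow> real) \<Rightarrow> ('a set \<Rightarrow> real) \<Rightarrow> real" where
  "W_ve G w we =
     (\<Sum>v\<in>verts G. \<Sum>e\<in>edges G. w v * we e * real (gdist_edge G v e))"

definition R_rel :: "'a ugraph \<Rightarrow> ('a \<times> 'a) set" where
  "R_rel G = {(u, v). u \<in> verts G \<and> v \<in> verts G \<and> nbhd G u = nbhd G v}"

lemma equiv_R_rel: "equiv (verts G) (R_rel G)"
  by (auto simp: equiv_def R_rel_def refl_on_def sym_def trans_def)

definition R_class :: "'a ugraph \<Rightarrow> 'a \<Rightarrow> 'a set" where
  "R_class G v = R_rel G `` {v}"

definition delete_verts :: "'a ugraph \<Rightarrow> 'a set \<Rightarrow> 'a ugraph" where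
  "delete_verts G S =
     \<lparr>verts = verts G - S, edges = {e \<in> edges G. e \<inter> S = {}}\<rparr>"

definition incident_edges :: "'a ugraph \<Rightarrow> 'a \<Rightarrow> 'a set set" where
  "incident_edges G v = {{v, n} |n. n \<in> nbhd G v}"

end

theory Submission
  imports Defs
begin

text \<open>For \<open>x \<in> C\<close>, the map collapsing \<open>C\<close> to \<open>x\<close> is a graph endomorphism of \<open>G\<close>, because \<open>C\<close> is
  independent with a common neighbourhood; for \<open>x = c\<close> its image is \<open>G'\<close>. Homomorphisms do not
  increase distances, so collapsing preserves all distances except those between distinct
  vertices of \<open>C\<close>. Hence \<open>d(v, e)\<close> also is preserved, except for \<open>v \<in> C\<close> and \<open>e\<close> incident to
  another vertex of \<open>C\<close>, where it drops from 1 to 0. The weights \<open>w'\<close> and \<open>w\<^sub>e'\<close> are the sums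
  over the fibres of the collapsing map.\<close>

section \<open>Distances and homomorphisms\<close>

text \<open>Adjacent vertices cannot be identified when \<open>H\<close> is simple, since
  \<open>{f x, f x}\<close> is then no edge.\<close>

definition graph_hom :: "'a ugraph \<Rightarrow> 'b ugraph \<Rightarrow> ('a \<Rightarrow> 'b) \<Rightarrow> bool" where
  "graph_hom G H f \<longleftrightarrow>
     f ` verts G \<subseteq> verts H \<and>
     (\<forall>x\<in>verts G. \<forall>y\<in>verts G. {x, y} \<in> edges G \<longrightarrow> {f x, f y} \<in> edges H)"

text \<open>If a vertex \<open>y\<close> repeats, cutting out the segment between two of its
  occurrences leaves a shorter walk with the same ends. This is needed because the image of a path
  under a homomorphism may repeat vertices.\<close>

lemma walk_contains_path:
  assumes "p \<noteq> []" "set p \<subseteq> verts G" "successively (\<lambda>x y. {x, y} \<in> edges G) p"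
  shows "\<exists>q. path_between G (hd p) q (last p) \<and> length q \<le> length p"
  using assms
proof (induction "length p" arbitrary: p rule: less_induct)
  case less
  show ?case
  proof (cases "distinct p")
    case True
    then show ?thesis using less.prems by (auto simp: path_between_def)
  next
    case False
    then obtain xs ys zs y where p: "p = xs @ [y] @ ys @ [y] @ zs"
      using not_distinct_decomp by blast
    let ?p = "xs @ [y] @ zs"
    have "successively (\<lambda>x y. {x, y} \<in> edges G) ?p"
      using less.prems(3) unfolding p by (auto simp: successively_append_iff successively_Cons)
    moreover have "set ?p \<subseteq> verts G" "length ?p < length p"
      using less.prems(2) p by auto
    ultimately obtain q where "path_between G (hd ?p) q (last ?p)" "length q \<le> length ?p"
      using less.hyps[of ?p] by blast
    moreover have "hd ?p = hd p" "last ?p = last p"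
      unfolding p by (cases xs; simp)+
    ultimately show ?thesis using \<open>length ?p < length p\<close> by (metis less_imp_le order_trans)
  qed
qed

lemma path_between_hom:
  assumes hom: "graph_hom G H f" and p: "path_between G u p v"
  shows "\<exists>q. path_between H (f u) q (f v) \<and> length q \<le> length p"
proof -
  have "successively (\<lambda>x y. {f x, f y} \<in> edges H) p"
    using p hom unfolding path_between_def graph_hom_def
    by (elim conjE successively_mono) blast+
  then have "successively (\<lambda>x y. {x, y} \<in> edges H) (map f p)"
    by (simp add: successively_map)
  moreover have "map f p \<noteq> []" "set (map f p) \<subseteq> verts H" "hd (map f p) = f u"
    "last (map f p) = f v"
    using p hom by (auto simp: path_between_def graph_hom_def hd_map last_map image_subset_iff subset_iff)
  ultimately show ?thesis using walk_contains_path[of "map f p" H] by simp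
qed

lemma gdist_le: "path_between G u p v \<Longrightarrow> gdist G u v \<le> length p - 1"
  unfolding gdist_def by (rule Least_le) blast

lemma gdist_attained:
  assumes "connected_graph G" "u \<in> verts G" "v \<in> verts G"
  shows "\<exists>p. path_between G u p v \<and> gdist G u v = length p - 1"
proof -
  obtain p where "path_between G u p v"
    using assms unfolding connected_graph_def by blast
  then have "\<exists>n p. path_between G u p v \<and> n = length p - 1" by blast
  then show ?thesis unfolding gdist_def by (rule LeastI_ex)
qed

text \<open>The image of a shortest path is a walk and hence contains a path that is no longer.
  Connectedness of \<open>G\<close> guarantees that the minimum defining \<open>gdist G u v\<close>
  is attained.\<close>

lemma gdist_hom_le:
  assumes "graph_hom G H f" "connected_graph G" "u \<in> verts G" "v \<in> verts G"
  shows "gdist H (f u) (f v) \<le> gdist G u v"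
proof -
  obtain p where p: "path_between G u p v" "gdist G u v = length p - 1"
    using gdist_attained[OF assms(2-)] by blast
  obtain q where "path_between H (f u) q (f v)" "length q \<le> length p"
    using path_between_hom[OF assms(1) p(1)] by blast
  with gdist_le[of H "f u" q "f v"] p(2) show ?thesis by linarith
qed

lemma connected_graph_hom_surj:
  assumes "graph_hom G H f" "connected_graph G" "f ` verts G = verts H"
  shows "connected_graph H"
  unfolding connected_graph_def
proof (intro conjI ballI)
  show "verts H \<noteq> {}" using assms(2,3) by (auto simp: connected_graph_def)
  fix u v assume "u \<in> verts H" "v \<in> verts H"
  then obtain u' v' where "u' \<in> verts G" "v' \<in> verts G" "u = f u'" "v = f v'"
    using assms(3) by blast
  moreover obtain p where "path_between G u' p v'"
    using calculation assms(2) unfolding connected_graph_def by blast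
  ultimately show "\<exists>p. path_between H u p v"
    using path_between_hom[OF assms(1)] by blast
qed

lemma gdist_self: "u \<in> verts G \<Longrightarrow> gdist G u u = 0"
  using gdist_le[of G u "[u]" u] by (simp add: path_between_def)

lemma gdist_adjacent_le:
  assumes "u \<in> verts G" "v \<in> verts G" "u \<noteq> v" "{u, v} \<in> edges G"
  shows "gdist G u v \<le> 1"
  using gdist_le[of G u "[u, v]" v] assms by (simp add: path_between_def)

lemma gdist_pos:
  assumes "connected_graph G" "u \<in> verts G" "v \<in> verts G" "u \<noteq> v"
  shows "gdist G u v \<ge> 1"
proof -
  obtain p where p: "path_between G u p v" "gdist G u v = length p - 1"
    using gdist_attained[OF assms(1-3)] by blast
  \<comment> \<open>Truncated subtraction gives \<open>length p - 1 = 0\<close> for both lengths 0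
    and 1. The first is excluded as paths are nonempty, the second because
    \<open>u \<noteq> v\<close>.\<close>
  have "length p \<noteq> 0" "length p \<noteq> 1"
    using p(1) assms(4) by (auto simp: path_between_def length_Suc_conv)
  with p(2) show ?thesis by linarith
qed

section \<open>Collapsing a class of twins\<close>

locale twin_class =
  fixes G :: "'a ugraph" and c :: 'a
  assumes simple: "simple_graph G" and conn: "connected_graph G" and c_vert: "c \<in> verts G"
begin

definition C :: "'a set" where "C = R_class G c"

definition G' :: "'a ugraph" where "G' = delete_verts G (C - {c})"

text \<open>The target \<open>x\<close> is a parameter because the two directions of the distance
  comparison use different targets: \<open>c\<close> to reach \<open>G'\<close>, and a suitable
  member of \<open>C\<close> to return to \<open>G\<close>.\<close>

definition collapse :: "'a \<Rightarrow> 'a \<Rightarrow> 'a" where "collapse x v = (if v \<in> C then x else v)"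

abbreviation I where "I \<equiv> incident_edges G"

section \<open>The twin class, its independence and its incident edges\<close>

lemma C_iff: "x \<in> C \<longleftrightarrow> x \<in> verts G \<and> nbhd G x = nbhd G c"
  using c_vert by (auto simp: C_def R_class_def R_rel_def)

lemma c_in_C: "c \<in> C"
  using c_vert by (simp add: C_iff)

lemma C_verts: "C \<subseteq> verts G"
  by (auto simp: C_iff)

lemma finite_verts: "finite (verts G)"
  using simple by (simp add: simple_graph_def)

lemma finite_C: "finite C"
  using finite_verts C_verts finite_subset by blast

lemma finite_edges: "finite (edges G)"
  using simple finite_verts finite_subset[of "edges G" "Pow (verts G)"]
  by (auto simp: simple_graph_def)

lemma edge_doubletonE:
  assumes "e \<in> edges G"
  obtains x y where "e = {x, y}" "x \<noteq> y" "x \<in> verts G" "y \<in> verts G"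
  using assms simple unfolding simple_graph_def
  by (metis card_2_iff insert_subset)

lemma edge_neq: "{x, y} \<in> edges G \<Longrightarrow> x \<noteq> y"
  using simple unfolding simple_graph_def by fastforce

lemma edge_verts: "{x, y} \<in> edges G \<Longrightarrow> x \<in> verts G \<and> y \<in> verts G"
  using simple unfolding simple_graph_def by blast

lemma edge_iff_nbhd: "{x, y} \<in> edges G \<longleftrightarrow> y \<in> nbhd G x"
  using edge_verts by (auto simp: nbhd_def)

text \<open>A neighbour \<open>n\<close> of \<open>c\<close> inside \<open>C\<close> would satisfy
  \<open>nbhd G n = nbhd G c\<close> and so be its own neighbour. Hence \<open>C\<close> is
  independent.\<close>

lemma nbhd_c_disjoint: "n \<in> nbhd G c \<Longrightarrow> n \<notin> C"
  using edge_iff_nbhd edge_neq C_iff by metis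

lemma C_edge_iff: "x \<in> C \<Longrightarrow> {x, y} \<in> edges G \<longleftrightarrow> y \<in> nbhd G c"
  by (simp add: edge_iff_nbhd C_iff)

lemma C_edge_iff': "x \<in> C \<Longrightarrow> {y, x} \<in> edges G \<longleftrightarrow> y \<in> nbhd G c"
  by (metis C_edge_iff insert_commute)

lemma incident_edges_C: "x \<in> C \<Longrightarrow> I x = (\<lambda>n. {x, n}) ` nbhd G c"
  by (auto simp: incident_edges_def C_iff)

lemma mem_incident_iff:
  assumes "x \<in> C"
  shows "e \<in> I x \<longleftrightarrow> e \<in> edges G \<and> x \<in> e"
proof
  assume "e \<in> edges G \<and> x \<in> e"
  then obtain n where "e = {x, n}" "{x, n} \<in> edges G"
    by (metis edge_doubletonE insertE insert_commute singletonD)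
  then show "e \<in> I x" using assms C_edge_iff incident_edges_C by auto
qed (use assms C_edge_iff in \<open>auto simp: incident_edges_C\<close>)

lemma card_incident: "x \<in> C \<Longrightarrow> card (I x) = card (nbhd G c)"
  unfolding incident_edges_C by (intro card_image inj_onI) (auto simp: doubleton_eq_iff)

text \<open>A common edge would join two members of the independent set \<open>C\<close>.
  Disjointness later turns a sum over a union into a double sum.\<close>

lemma incident_disjoint:
  assumes "x \<in> C" "y \<in> C" "x \<noteq> y"
  shows "I x \<inter> I y = {}"
  using assms nbhd_c_disjoint by (auto simp: incident_edges_C doubleton_eq_iff)

lemma verts_G': "verts G' = verts G - (C - {c})"
  by (simp add: G'_def delete_verts_def)

lemma edges_G': "edges G' = {e \<in> edges G. e \<inter> (C - {c}) = {}}"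
  by (simp add: G'_def delete_verts_def)

section \<open>Collapsing maps as homomorphisms\<close>

lemma collapse_edge:
  assumes "x \<in> C" "{u, v} \<in> edges G"
  shows "{collapse x u, collapse x v} \<in> edges G"
proof -
  \<comment> \<open>At most one end is moved, and it moves to a twin with the same
    neighbours.\<close>
  have "\<not> (u \<in> C \<and> v \<in> C)"
    using assms C_edge_iff nbhd_c_disjoint by blast
  then show ?thesis
    using assms by (auto simp: collapse_def C_edge_iff C_edge_iff')
qed

lemma collapse_hom: "x \<in> C \<Longrightarrow> graph_hom G G (collapse x)"
  using collapse_edge C_verts unfolding graph_hom_def by (auto simp: collapse_def)

lemma collapse_hom_G': "graph_hom G G' (collapse c)"
  using collapse_edge[OF c_in_C] C_verts c_in_C unfolding graph_hom_def
  by (auto simp: collapse_def verts_G' edges_G')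

lemma collapse_hom_from_G': "x \<in> C \<Longrightarrow> graph_hom G' G (collapse x)"
  using collapse_hom[of x] by (auto simp: graph_hom_def verts_G' edges_G')

lemma collapse_image: "collapse c ` verts G = verts G'"
  using c_in_C c_vert by (auto simp: collapse_def verts_G' image_iff)

lemma conn_G': "connected_graph G'"
  using connected_graph_hom_surj collapse_hom_G' conn collapse_image by blast

lemma collapse_verts: "u \<in> verts G \<Longrightarrow> collapse c u \<in> verts G'"
  using collapse_image by blast

section \<open>Distances under collapsing\<close>

lemma gdist_collapse:
  assumes u: "u \<in> verts G" and v: "v \<in> verts G" and uv: "u \<in> C \<Longrightarrow> v \<in> C \<Longrightarrow> u = v"
  shows "gdist G' (collapse c u) (collapse c v) = gdist G u v"
proof (rule antisym)
  show "gdist G' (collapse c u) (collapse c v) \<le> gdist G u v"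
    using gdist_hom_le[OF collapse_hom_G' conn u v] .
  \<comment> \<open>Collapsing to \<open>c\<close> and then to \<open>x\<close> must fix both
    \<open>u\<close> and \<open>v\<close>, so \<open>x\<close> is whichever of them lies in
    \<open>C\<close>. By \<open>uv\<close> there is no conflict; if neither lies in
    \<open>C\<close>, the value \<open>c\<close> is a mere default.\<close>
  define x where "x = (if u \<in> C then u else if v \<in> C then v else c)"
  have x: "x \<in> C" using c_in_C by (simp add: x_def)
  have "collapse x (collapse c u) = u" "collapse x (collapse c v) = v"
    using uv c_in_C by (auto simp: collapse_def x_def)
  then show "gdist G u v \<le> gdist G' (collapse c u) (collapse c v)"
    using gdist_hom_le[OF collapse_hom_from_G'[OF x] conn_G' collapse_verts[OF u] collapse_verts[OF v]]
    by simp
qed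

text \<open>Unless \<open>v\<close> lies in \<open>C\<close> and \<open>e\<close> meets
  \<open>C\<close>, the distances to both ends are preserved. Otherwise the collapsed distance is 0,
  and the original one is 0 or 1 according to whether \<open>v\<close> is an end of
  \<open>e\<close>.\<close>

lemma gdist_edge_collapse:
  assumes v: "v \<in> verts G" and e: "e \<in> edges G"
  shows "gdist_edge G v e = gdist_edge G' (collapse c v) (collapse c ` e)
           + (if v \<in> C \<and> e \<in> (\<Union>y\<in>C - {v}. I y) then 1 else 0)"
proof (cases "v \<in> C \<and> e \<inter> C \<noteq> {}")
  case False
  obtain x y where xy: "e = {x, y}" "x \<in> verts G" "y \<in> verts G"
    using edge_doubletonE[OF e] by metis
  have "\<not> (v \<in> C \<and> e \<in> (\<Union>y\<in>C - {v}. I y))"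
    using False mem_incident_iff by blast
  moreover have "gdist G' (collapse c v) (collapse c x) = gdist G v x"
    "gdist G' (collapse c v) (collapse c y) = gdist G v y"
    using False xy v by (auto intro!: gdist_collapse)
  ultimately show ?thesis
    using xy(1) by (simp add: gdist_edge_doubleton)
next
  case True
  then obtain y where y: "y \<in> C" "y \<in> e" and v': "v \<in> C" by blast
  then obtain n where n: "e = {y, n}" "n \<in> nbhd G c"
    using e mem_incident_iff[of y e] incident_edges_C[of y] by blast
  have nC: "n \<notin> C" and nv: "n \<in> verts G"
    using nbhd_c_disjoint[OF n(2)] n(2) by (simp_all add: nbhd_def)
  have "gdist G' c c = 0"
    using c_vert by (intro gdist_self) (simp add: verts_G')
  then have d': "gdist_edge G' (collapse c v) (collapse c ` e) = 0"
    using y v' n nC by (simp add: gdist_edge_doubleton collapse_def)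
  show ?thesis
  proof (cases "y = v")
    case True
    \<comment> \<open>The other end \<open>n\<close> is outside \<open>C\<close>, so no second
      member of \<open>C\<close> is incident to \<open>e\<close>.\<close>
    then have "e \<notin> (\<Union>y\<in>C - {v}. I y)"
      using n nC mem_incident_iff by auto
    then show ?thesis
      using True d' n(1) gdist_self[OF v] by (simp add: gdist_edge_doubleton)
  next
    case False
    have "e \<in> I y" using mem_incident_iff y e by blast
    then have "e \<in> (\<Union>y\<in>C - {v}. I y)" using y False by blast
    moreover have "gdist G v y \<ge> 1"
      using gdist_pos[OF conn v] y C_verts False by blast
    \<comment> \<open>As \<open>v\<close> and \<open>y\<close> are twins, \<open>n\<close> is also a
      neighbour of \<open>v\<close>, so the minimum over the ends of \<open>e\<close> is exactly
      1.\<close>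
    moreover have "gdist G v n \<le> 1" "gdist G v n \<ge> 1"
      using gdist_adjacent_le[OF v nv] gdist_pos[OF conn v nv] C_edge_iff[OF v'] n(2) nC v' by metis+
    ultimately show ?thesis
      using d' n(1) v' by (simp add: gdist_edge_doubleton)
  qed
qed

lemma collapse_edge_G':
  assumes "e \<in> edges G"
  shows "collapse c ` e \<in> edges G'"
proof -
  obtain x y where "e = {x, y}" "x \<in> verts G" "y \<in> verts G"
    using edge_doubletonE[OF assms] by metis
  then show ?thesis
    using assms collapse_hom_G' by (simp add: graph_hom_def)
qed

section \<open>Fibres of the collapsing map on vertices and edges\<close>

lemma collapse_vert_fibre:
  assumes "v \<in> verts G'"
  shows "{u \<in> verts G. collapse c u = v} = (if v = c then C else {v})"
  using assms C_verts c_in_C by (auto simp: collapse_def verts_G')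

lemma collapse_image_id: "e \<inter> C = {} \<Longrightarrow> collapse c ` e = e"
  by (force simp: collapse_def image_iff)

lemma collapse_incident:
  assumes "x \<in> C" "n \<in> nbhd G c"
  shows "collapse c ` {x, n} = {c, n}"
  using assms nbhd_c_disjoint by (auto simp: collapse_def)

lemma edge_casesE:
  assumes "e \<in> edges G"
  obtains (off) "e \<inter> C = {}" | (inc) x n where "x \<in> C" "n \<in> nbhd G c" "e = {x, n}"
proof (cases "e \<inter> C = {}")
  case False
  then obtain x where "x \<in> C" "x \<in> e" by blast
  then have "e \<in> (\<lambda>n. {x, n}) ` nbhd G c"
    using assms mem_incident_iff incident_edges_C by blast
  then show ?thesis using inc \<open>x \<in> C\<close> by blast
qed (rule off)

text \<open>Any edge meeting \<open>C\<close> has an image containing \<open>c\<close>, so only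
  \<open>e\<close> itself can be sent to \<open>e\<close>.\<close>

lemma collapse_edge_fibre_off:
  assumes "e \<in> edges G" "e \<inter> C = {}"
  shows "{f \<in> edges G. collapse c ` f = e} = {e}"
proof -
  have "f = e" if "f \<in> edges G" "collapse c ` f = e" for f
    using that(1)
  proof (cases rule: edge_casesE)
    case off
    then show ?thesis using that(2) collapse_image_id by simp
  next
    case (inc x n)
    then show ?thesis using that(2) assms(2) c_in_C collapse_incident by auto
  qed
  moreover have "collapse c ` e = e" using assms(2) by (rule collapse_image_id)
  ultimately show ?thesis using assms(1) by blast
qed

text \<open>One edge per member of \<open>C\<close> lies over \<open>{c, n}\<close>; these are the
  edges whose weights are merged in \<open>we' {c, n}\<close>.\<close>

lemma collapse_edge_fibre_inc:
  assumes "n \<in> nbhd G c"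
  shows "{f \<in> edges G. collapse c ` f = {c, n}} = (\<lambda>x. {x, n}) ` C"
proof -
  have "f \<in> (\<lambda>x. {x, n}) ` C" if "f \<in> edges G" "collapse c ` f = {c, n}" for f
    using that(1)
  proof (cases rule: edge_casesE)
    case off
    then show ?thesis using that(2) collapse_image_id c_in_C by auto
  next
    case (inc x m)
    then have "{c, m} = {c, n}" using that(2) collapse_incident by simp
    then have "m = n" by (auto simp: doubleton_eq_iff)
    then show ?thesis using inc by blast
  qed
  moreover have "{x, n} \<in> edges G \<and> collapse c ` {x, n} = {c, n}" if "x \<in> C" for x
    using that assms collapse_incident C_edge_iff by blast
  ultimately show ?thesis by blast
qed

section \<open>Summation over fibres and the correction term\<close>

lemma W_ve_collapse:
  assumes w'_c: "w' c = (\<Sum>x\<in>C. w x)"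
    and w'_off: "\<And>v. v \<in> verts G - C \<Longrightarrow> w' v = w v"
    and we'_c: "\<And>n. n \<in> nbhd G c \<Longrightarrow> we' {c, n} = (\<Sum>x\<in>C. we {x, n})"
    and we'_off: "\<And>e. e \<in> edges G - (\<Union>x\<in>C. I x) \<Longrightarrow> we' e = we e"
  shows "W_ve G' w' we' = (\<Sum>v\<in>verts G. \<Sum>e\<in>edges G.
           w v * we e * real (gdist_edge G' (collapse c v) (collapse c ` e)))"
proof -
  \<comment> \<open>Both new weights are push-forwards along \<open>collapse c\<close>: each value
    is the total weight of a fibre.\<close>
  have w': "w' v = (\<Sum>u | u \<in> verts G \<and> collapse c u = v. w u)" if "v \<in> verts G'" for v
    using that w'_c w'_off[of v] by (auto simp: collapse_vert_fibre verts_G')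
  have we': "we' e = (\<Sum>f | f \<in> edges G \<and> collapse c ` f = e. we f)" if "e \<in> edges G'" for e
  proof -
    have e: "e \<in> edges G" "e \<inter> (C - {c}) = {}" using that edges_G' by auto
    from e(1) show ?thesis
    proof (cases rule: edge_casesE)
      case off
      then show ?thesis
        using collapse_edge_fibre_off e(1) we'_off[of e] mem_incident_iff by auto
    next
      case (inc x n)
      \<comment> \<open>An edge surviving in \<open>G'\<close> can meet \<open>C\<close> only in
        \<open>c\<close>.\<close>
      then have "x = c" using e(2) by auto
      moreover have "inj_on (\<lambda>x. {x, n}) C" by (auto simp: inj_on_def doubleton_eq_iff)
      ultimately show ?thesis
        using inc we'_c by (simp add: collapse_edge_fibre_inc sum.reindex)
    qed
  qed
  have "W_ve G' w' we' = (\<Sum>v\<in>verts G'. w' v * (\<Sum>e\<in>edges G'. we' e * real (gdist_edge G' v e)))"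
    by (simp add: W_ve_def sum_distrib_left mult.assoc)
  also have "\<dots> = (\<Sum>v\<in>verts G'. w' v * (\<Sum>e\<in>edges G. we e * real (gdist_edge G' v (collapse c ` e))))"
  proof (rule sum.cong[OF refl], rule arg_cong[where f = "(*) _"])
    fix v
    \<comment> \<open>On the fibre over \<open>e\<close> the distance is rewritten in terms of
      \<open>f\<close>. The summand then depends on \<open>f\<close> alone, and the fibres partition
      \<open>edges G\<close>.\<close>
    have "(\<Sum>e\<in>edges G'. we' e * real (gdist_edge G' v e)) =
          (\<Sum>e\<in>edges G'. \<Sum>f | f \<in> edges G \<and> collapse c ` f = e.
             we f * real (gdist_edge G' v (collapse c ` f)))"
      by (intro sum.cong refl) (simp add: we' sum_distrib_right)
    also have "\<dots> = (\<Sum>e\<in>edges G. we e * real (gdist_edge G' v (collapse c ` e)))"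
      using finite_edges collapse_edge_G' by (intro sum.group) (auto simp: edges_G')
    finally show "(\<Sum>e\<in>edges G'. we' e * real (gdist_edge G' v e)) = \<dots>" .
  qed
  also have "\<dots> = (\<Sum>v\<in>verts G'. \<Sum>u | u \<in> verts G \<and> collapse c u = v.
      w u * (\<Sum>e\<in>edges G. we e * real (gdist_edge G' (collapse c u) (collapse c ` e))))"
    by (intro sum.cong refl) (simp add: w' sum_distrib_right)
  also have "\<dots> = (\<Sum>u\<in>verts G.
      w u * (\<Sum>e\<in>edges G. we e * real (gdist_edge G' (collapse c u) (collapse c ` e))))"
    using finite_verts collapse_verts by (intro sum.group) (auto simp: verts_G')
  finally show ?thesis
    by (simp add: sum_distrib_left mult.assoc)
qed

text \<open>The indicator restricts \<open>v\<close> to \<open>C\<close> and \<open>e\<close> to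
  edges at the other members of \<open>C\<close>; disjointness of the sets \<open>I y\<close> splits
  the inner sum.\<close>

lemma sum_twin_correction:
  fixes w :: "'a \<Rightarrow> real" and we :: "'a set \<Rightarrow> real"
  shows "(\<Sum>v\<in>verts G. \<Sum>e\<in>edges G.
            w v * we e * (if v \<in> C \<and> e \<in> (\<Union>y\<in>C - {v}. I y) then 1 else 0))
         = (\<Sum>x\<in>C. \<Sum>y\<in>C - {x}. \<Sum>e\<in>I y. w x * we e)" (is "?L = ?R")
proof -
  have fin: "finite (I y)" if "y \<in> C" for y
    using that finite_edges mem_incident_iff by (intro finite_subset[of "I y" "edges G"]) auto
  have "?L = (\<Sum>x\<in>C. \<Sum>e\<in>edges G. w x * we e * (if x \<in> C \<and> e \<in> (\<Union>y\<in>C - {x}. I y) then 1 else 0))"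
    using finite_verts C_verts by (intro sum.mono_neutral_right) auto
  also have "\<dots> = (\<Sum>x\<in>C. \<Sum>e\<in>(\<Union>y\<in>C - {x}. I y). w x * we e)"
    using finite_edges mem_incident_iff
    by (intro sum.cong refl sum.mono_neutral_cong_right) auto
  also have "\<dots> = ?R"
    using finite_C fin incident_disjoint by (intro sum.cong refl sum.UNION_disjoint) auto
  finally show ?thesis .
qed

lemma W_ve_twin_class:
  assumes "w' c = (\<Sum>x\<in>C. w x)"
    and "\<And>v. v \<in> verts G - C \<Longrightarrow> w' v = w v"
    and "\<And>n. n \<in> nbhd G c \<Longrightarrow> we' {c, n} = (\<Sum>x\<in>C. we {x, n})"
    and "\<And>e. e \<in> edges G - (\<Union>x\<in>C. I x) \<Longrightarrow> we' e = we e"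
  shows "W_ve G w we = W_ve G' w' we' + (\<Sum>x\<in>C. \<Sum>y\<in>C - {x}. \<Sum>e\<in>I y. w x * we e)"
proof -
  have "W_ve G w we = (\<Sum>v\<in>verts G. \<Sum>e\<in>edges G.
      w v * we e * real (gdist_edge G' (collapse c v) (collapse c ` e)) +
      w v * we e * (if v \<in> C \<and> e \<in> (\<Union>y\<in>C - {v}. I y) then 1 else 0))"
    unfolding W_ve_def
    by (intro sum.cong refl) (simp only: gdist_edge_collapse of_nat_add distrib_left of_nat_1 of_nat_0 if_distrib[of real])
  then show ?thesis
    by (simp only: sum.distrib sum_twin_correction W_ve_collapse[of w' w we' we, OF assms])
qed

text \<open>There are \<open>k(k-1)\<close> ordered pairs of distinct members of \<open>C\<close>,
  and each contributes \<open>s\<close> edges of value \<open>a * b\<close>.\<close>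

lemma sum_twin_constant:
  fixes w :: "'a \<Rightarrow> real" and we :: "'a set \<Rightarrow> real"
  assumes "\<And>x. x \<in> C \<Longrightarrow> w x = a" "\<And>e. e \<in> (\<Union>x\<in>C. I x) \<Longrightarrow> we e = b"
  shows "(\<Sum>x\<in>C. \<Sum>y\<in>C - {x}. \<Sum>e\<in>I y. w x * we e)
         = a * b * real (card C) * (real (card C) - 1) * real (card (nbhd G c))"
proof -
  have "(\<Sum>x\<in>C. \<Sum>y\<in>C - {x}. \<Sum>e\<in>I y. w x * we e)
        = (\<Sum>x\<in>C. \<Sum>y\<in>C - {x}. a * b * real (card (nbhd G c)))"
  proof (intro sum.cong refl)
    fix x y assume "x \<in> C" "y \<in> C - {x}"
    then have "(\<Sum>e\<in>I y. w x * we e) = (\<Sum>e\<in>I y. a * b)"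
      using assms by (intro sum.cong refl) auto
    then show "(\<Sum>e\<in>I y. w x * we e) = a * b * real (card (nbhd G c))"
      using \<open>y \<in> C - {x}\<close> by (simp add: card_incident)
  qed
  also have "\<dots> = (\<Sum>x\<in>C. (real (card C) - 1) * (a * b * real (card (nbhd G c))))"
  proof (intro sum.cong refl)
    fix x assume "x \<in> C"
    \<comment> \<open>Since \<open>x\<close> lies in \<open>C\<close>, the cardinality is at least 1
      and the natural subtraction agrees with the real one.\<close>
    then have "real (card (C - {x})) = real (card C) - 1"
      using finite_C by (metis card_Diff_singleton card_gt_0_iff empty_iff of_nat_1 of_nat_diff
          One_nat_def Suc_leI)
    then show "(\<Sum>y\<in>C - {x}. a * b * real (card (nbhd G c)))
        = (real (card C) - 1) * (a * b * real (card (nbhd G c)))"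
      by simp
  qed
  finally show ?thesis by simp
qed

end

theorem theorem4p3:
  fixes G G' :: "'a ugraph"
    and w w' :: "'a \<Rightarrow> real"
    and we we' :: "'a set \<Rightarrow> real"
    and c :: 'a
    and C :: "'a set"
  assumes "simple_graph G"
    and "connected_graph G"
    and "\<forall>v\<in>verts G. 0 \<le> w v"
    and "\<forall>e\<in>edges G. 0 \<le> we e"
    and "c \<in> verts G"
    and "C = R_class G c"
    and "G' = delete_verts G (C - {c})"
    and "w' c = (\<Sum>x\<in>C. w x)"
    and "\<forall>v\<in>verts G - C. w' v = w v"
    and "\<forall>n\<in>nbhd G c. we' {c, n} = (\<Sum>x\<in>C. we {x, n})"
    and "\<forall>e\<in>edges G - (\<Union>x\<in>C. incident_edges G x). we' e = we e"
  shows "W_ve G w we = W_ve G' w' we'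
           + (\<Sum>x\<in>C. \<Sum>y\<in>C - {x}. \<Sum>e\<in>incident_edges G y. w x * we e)
    \<and> (\<forall>a b :: real. 0 \<le> a \<longrightarrow> 0 \<le> b \<longrightarrow>
          (\<forall>x\<in>C. w x = a) \<longrightarrow>
          (\<forall>e\<in>(\<Union>x\<in>C. incident_edges G x). we e = b) \<longrightarrow>
          W_ve G w we = W_ve G' w' we'
            + a * b * real (card C) * (real (card C) - 1) * real (card (nbhd G c)))"
proof -
  interpret twin_class G c
    using assms(1,2,5) by unfold_locales
  \<comment> \<open>The variables of the statement are identified with the constants of the locale,
    so that its lemmas apply.\<close>
  have CG: "C = local.C" "G' = local.G'"
    using assms(6,7) by (simp_all add: C_def G'_def)
  have main: "W_ve G w we = W_ve G' w' we'
      + (\<Sum>x\<in>C. \<Sum>y\<in>C - {x}. \<Sum>e\<in>incident_edges G y. w x * we e)"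
    unfolding CG by (rule W_ve_twin_class) (use assms(8-11) CG in auto)
  show ?thesis
  proof (intro conjI allI impI)
    fix a b :: real
    assume "\<forall>x\<in>C. w x = a" "\<forall>e\<in>(\<Union>x\<in>C. incident_edges G x). we e = b"
    then have "(\<Sum>x\<in>C. \<Sum>y\<in>C - {x}. \<Sum>e\<in>incident_edges G y. w x * we e)
        = a * b * real (card C) * (real (card C) - 1) * real (card (nbhd G c))"
      unfolding CG by (intro sum_twin_constant) blast+
    then show "W_ve G w we = W_ve G' w' we'
        + a * b * real (card C) * (real (card C) - 1) * real (card (nbhd G c))"
      using main by simp
  qed (rule main)
qed

end
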